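(* Let $G$ be a connected graph with a bivalent or trivalent eigenvector $\mathbf v$ of its Laplacian, affording an eigenvalue $\lambda$, such that $G$ has no equal links for $\mathbf v$. If $G$ has a leaf (a vertex of degree 1), then either $G$ is the chain $P_2$ (with eigenvector $[1,-1]^T$ and $\lambda=2$), or $G$ is a star $S_{2k+1}$ for some integer $k\ge 1$ (with eigenvector $[0,-1,1,\ldots,-1,1]^T$, whose first entry is the value at the center, so that the center is a soft node, and $\lambda=1$).
   Context: Graphs are finite, simple and undirected. The Laplacian of a graph $G$ with vertex set $\{1,\dots,n\}$ is $L(G)=D-A$, where $D$ is the diagonal matrix of vertex degrees and $A$ is the adjacency matrix. An eigenvector of $L(G)$ is bivalent if it is composed of the values $\{-1,+1\}$ and trivalent if it is composed of the values $\{-1,0,+1\}$ (the set of values of its entries is exactly the indicated set). For an eigenvector $\mathbf v$, a vertex $j$ is a soft node if $v_j=0$; an equal link is an edge $ij$ with $v_i=v_j$. $P_2$ is the path on two vertices (a single edge). $S_{2k+1}$ is the star with $2k+1$ vertices: a center adjacent to $2k$ leaves. The eigenvectors displayed are up to labeling of the vertices. *)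

theory Defs
  imports "Graph_Theory.Graph_Theory" "Jordan_Normal_Form.Char_Poly"
begin

text \<open>A finite simple undirected graph is a \<^locale>\<open>pair_graph\<close>: every edge is a pair of opposite
  arcs, there are no loops and no parallel arcs, so the degree of a vertex is its out-degree.
  Matrices and vectors are indexed from 0, so the vertex set is \<open>{0..<n}\<close>.\<close>

definition degree_matrix :: "nat \<Rightarrow> nat pair_pre_digraph \<Rightarrow> real mat" where
  "degree_matrix n G = mat_diag n (\<lambda>i. real (out_degree (with_proj G) i))"

definition adjacency_matrix :: "nat \<Rightarrow> nat pair_pre_digraph \<Rightarrow> real mat" where
  "adjacency_matrix n G = mat n n (\<lambda>(i, j). if (i, j) \<in> parcs G then 1 else 0)"

definition laplacian :: "nat \<Rightarrow> nat pair_pre_digraph \<Rightarrow> real mat" where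
  "laplacian n G = degree_matrix n G - adjacency_matrix n G"

definition bivalent :: "real vec \<Rightarrow> bool" where
  "bivalent v \<longleftrightarrow> vec_set v = {-1, 1}"

definition trivalent :: "real vec \<Rightarrow> bool" where
  "trivalent v \<longleftrightarrow> vec_set v = {-1, 0, 1}"

definition soft_node :: "nat pair_pre_digraph \<Rightarrow> real vec \<Rightarrow> nat \<Rightarrow> bool" where
  "soft_node G v j \<longleftrightarrow> j \<in> pverts G \<and> v $ j = 0"

definition equal_link :: "nat pair_pre_digraph \<Rightarrow> real vec \<Rightarrow> nat \<Rightarrow> nat \<Rightarrow> bool" where
  "equal_link G v i j \<longleftrightarrow> (i, j) \<in> parcs G \<and> v $ i = v $ j"

definition leaf :: "nat pair_pre_digraph \<Rightarrow> nat \<Rightarrow> bool" where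
  "leaf G j \<longleftrightarrow> j \<in> pverts G \<and> out_degree (with_proj G) j = 1"

definition path_graph :: "nat \<Rightarrow> nat pair_pre_digraph" where
  "path_graph n = \<lparr> pverts = {0..<n},
     parcs = {(i, j). i < n \<and> j < n \<and> (j = Suc i \<or> i = Suc j)} \<rparr>"

text \<open>The parameter is the total number of vertices; the center is the vertex 0.\<close>

definition star_graph :: "nat \<Rightarrow> nat pair_pre_digraph" where
  "star_graph n = \<lparr> pverts = {0..<n},
     parcs = {(i, j). i < n \<and> j < n \<and> (i = 0 \<and> j \<noteq> 0 \<or> i \<noteq> 0 \<and> j = 0)} \<rparr>"

text \<open>The vector \<open>[0, -1, 1, \<dots>, -1, 1]\<close> of dimension \<open>2 * k + 1\<close>.\<close>

definition star_vec :: "nat \<Rightarrow> real vec" where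
  "star_vec k = vec (2 * k + 1) (\<lambda>i. if i = 0 then 0 else if odd i then -1 else 1)"

text \<open>Equality up to labeling of the vertices: \<open>f\<close> is an isomorphism from \<open>H\<close> onto \<open>G\<close>
  that carries the vector \<open>w\<close> on the vertices of \<open>H\<close> to the vector \<open>v\<close> on those of \<open>G\<close>.\<close>

definition relabeling ::
  "(nat, nat \<times> nat, nat, nat \<times> nat) digraph_isomorphism \<Rightarrow>
   nat pair_pre_digraph \<Rightarrow> real vec \<Rightarrow> nat pair_pre_digraph \<Rightarrow> real vec \<Rightarrow> bool" where
  "relabeling f H w G v \<longleftrightarrow>
     pre_digraph.digraph_isomorphism (with_proj H) f \<and>
     with_proj G = app_iso f (with_proj H) \<and>
     (\<forall>i \<in> pverts H. v $ (iso_verts f i) = w $ i)"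

end

theory Submission
  imports Defs
begin

text \<open>If \<open>v\<close> has values in \<open>{-1, 0, 1}\<close> and no equal links, multiplying the eigenvalue equation
  at a vertex \<open>i\<close> with \<open>v\<^sub>i \<noteq> 0\<close> by \<open>v\<^sub>i\<close> writes \<open>\<lambda>\<close> as a sum over the neighbours of \<open>i\<close> in which
  soft neighbours contribute 1 and the others contribute 2. A leaf is not soft, so it forces
  \<open>\<lambda> = 2\<close> or \<open>\<lambda> = 1\<close>. If \<open>\<lambda> = 2\<close>, the neighbour of the leaf has no other neighbour. If
  \<open>\<lambda> = 1\<close>, every non-soft vertex is a leaf attached to a soft vertex, and the equation at the soft
  center balances the leaves of value 1 against those of value -1.\<close>

text \<open>Connectedness speaks of the symmetric closure; symmetric arcs make reachability there
  the same as in \<open>G\<close>, and induction along a walk from \<open>u\<close> never leaves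
  \<open>S\<close>. This is how a small set around the leaf is shown to exhaust the graph.\<close>

lemma connected_arc_closed:
  assumes "pair_sym_digraph G" "Digraph_Component.connected (with_proj G)"
    and "u \<in> pverts G" "u \<in> S"
    and "\<And>i j. i \<in> S \<Longrightarrow> (i, j) \<in> parcs G \<Longrightarrow> j \<in> S"
  shows "pverts G \<subseteq> S"
proof
  interpret pair_sym_digraph G by fact
  fix w assume "w \<in> pverts G"
  then have "u \<rightarrow>\<^sup>*\<^bsub>with_proj (mk_symmetric (with_proj G))\<^esub> w"
    using assms(2,3) by (simp add: connected_def strongly_connected_def)
  then have "u \<rightarrow>\<^sup>*\<^bsub>with_proj G\<^esub> w"
    by (simp only: reachable_mk_symmetric_eq[OF pair_sym_arcs])
  then show "w \<in> S"
    using assms(4,5) by (induction rule: reachable_induct) auto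
qed

text \<open>Arcs are pairs of vertices, so \<open>g\<close> determines the arc map
  \<open>map_prod g g\<close>, which is injective on arcs since their ends lie in
  \<open>pverts H\<close>. Head and tail stay the projections.\<close>

lemma relabelingI:
  assumes "pair_wf_digraph H" "inj_on g (pverts H)"
    and "pverts G = g ` pverts H" "parcs G = map_prod g g ` parcs H"
    and "\<And>i. i \<in> pverts H \<Longrightarrow> v $ g i = w $ i"
  shows "relabeling \<lparr>iso_verts = g, iso_arcs = map_prod g g, iso_head = snd, iso_tail = fst\<rparr> H w G v"
proof -
  interpret H: pair_wf_digraph H by fact
  have "parcs H \<subseteq> pverts H \<times> pverts H"
    using H.wellformed' by auto
  then have "inj_on (map_prod g g) (parcs H)"
    using inj_on_subset map_prod_inj_on[OF assms(2) assms(2)] by blast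
  moreover have "wf_digraph (with_proj H)"
    using assms(1) wf_digraph_wp_iff by blast
  ultimately show ?thesis
    using assms by (auto simp: relabeling_def pre_digraph.digraph_isomorphism_def app_iso_def with_proj_def)
qed

lemma pair_wf_path_graph: "pair_wf_digraph (path_graph n)"
  by unfold_locales (auto simp: path_graph_def)

lemma pair_wf_star_graph: "pair_wf_digraph (star_graph n)"
  by unfold_locales (auto simp: star_graph_def)

lemma out_degree_eq_card_Image:
  "out_degree (with_proj G) i = card (parcs G `` {i})"
proof -
  have "out_arcs (with_proj G) i = Pair i ` (parcs G `` {i})"
    by (auto simp: out_arcs_def)
  then show ?thesis
    by (simp add: out_degree_def card_image inj_on_def)
qed

text \<open>In row \<open>i\<close> the diagonal entry counts the neighbours, so the degree term can
  be distributed over them, one \<open>v $ i\<close> for each subtracted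
  \<open>v $ j\<close>.\<close>

lemma laplacian_eigenvector_sum:
  assumes "pair_wf_digraph G" "pverts G = {0..<n}"
    and "eigenvector (laplacian n G) v lam" "i < n"
  shows "(\<Sum>j \<in> parcs G `` {i}. v $ i - v $ j) = lam * v $ i"
proof -
  interpret pair_wf_digraph G by fact
  let ?N = "parcs G `` {i}"
  have sub: "?N \<subseteq> {0..<n}"
    using wellformed' assms(2) by auto
  have dim: "dim_row (laplacian n G) = n" "dim_col (laplacian n G) = n"
    by (simp_all add: laplacian_def adjacency_matrix_def)
  have v: "v \<in> carrier_vec n" and ev: "laplacian n G *\<^sub>v v = lam \<cdot>\<^sub>v v"
    using assms(3) by (simp_all add: eigenvector_def dim)
  have "lam * v $ i = (laplacian n G *\<^sub>v v) $ i"
    using ev v assms(4) by simp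
  also have "\<dots> = (\<Sum>j = 0..<n. laplacian n G $$ (i, j) * v $ j)"
    using v assms(4) by (simp add: dim scalar_prod_def)
  also have "\<dots> = (\<Sum>j = 0..<n. (if j = i then real (card ?N) * v $ i else 0)
                              - (if j \<in> ?N then v $ j else 0))"
    using assms(4)
    by (intro sum.cong)
      (auto simp: laplacian_def degree_matrix_def adjacency_matrix_def mat_diag_def
        out_degree_eq_card_Image algebra_simps)
  also have "\<dots> = real (card ?N) * v $ i - (\<Sum>j \<in> ?N. v $ j)"
    using assms(4) sum.inter_restrict[of "{0..<n}" "($) v" ?N] sub
    by (simp add: sum_subtractf Int_absorb1)
  finally show ?thesis
    by (simp add: sum_subtractf)
qed

text \<open>Supplies a labeling in the order of \<open>star_vec\<close>: center first, then vertices
  of value -1 (\<open>M\<close>) at odd and of value 1 (\<open>P\<close>) at even positions.\<close>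

lemma bij_betw_even_odd_labels:
  assumes "finite P" "finite M" "card P = k" "card M = k" "P \<inter> M = {}" "c \<notin> P \<union> M"
  obtains g where "bij_betw g {0..<2 * k + 1} (insert c (P \<union> M))" "g 0 = c"
    "\<And>i. i < 2 * k + 1 \<Longrightarrow> i \<noteq> 0 \<Longrightarrow> if odd i then g i \<in> M else g i \<in> P"
proof -
  obtain p m where p: "bij_betw p {0..<k} P" and m: "bij_betw m {0..<k} M"
    using assms ex_bij_betw_nat_finite by metis
  let ?O = "{i. i < 2 * k + 1 \<and> odd i}"
  let ?E = "{i. i < 2 * k + 1 \<and> even i \<and> i \<noteq> 0}"
  \<comment> \<open>Both \<open>2 * t + 1\<close> and \<open>2 * t + 2\<close> are sent to
    \<open>t\<close>, so one formula numbers the odd and the positive even indices.\<close>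
  define h where "h = (\<lambda>i::nat. (i - 1) div 2)"
  have hO: "bij_betw h ?O {0..<k}"
    by (rule bij_betw_byWitness[where f' = "\<lambda>i. 2 * i + 1"]) (auto simp: h_def elim!: oddE)
  have hE: "bij_betw h ?E {0..<k}"
    by (rule bij_betw_byWitness[where f' = "\<lambda>i. 2 * i + 2"]) (auto simp: h_def elim!: evenE)
  define g where "g i = (if i = 0 then c else if odd i then m (h i) else p (h i))" for i
  have gO: "bij_betw g ?O M"
    using bij_betw_trans[OF hO m] by (rule iffD2[OF bij_betw_cong, rotated]) (auto simp: g_def)
  have gE: "bij_betw g ?E P"
    using bij_betw_trans[OF hE p] by (rule iffD2[OF bij_betw_cong, rotated]) (auto simp: g_def)
  have "bij_betw g ({0} \<union> (?E \<union> ?O)) ({c} \<union> (P \<union> M))"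
    using assms(5,6) by (intro bij_betw_combine gO gE) (auto simp: bij_betw_def g_def)
  moreover have "{0} \<union> (?E \<union> ?O) = {0..<2 * k + 1}"
    by auto
  ultimately have bij: "bij_betw g {0..<2 * k + 1} (insert c (P \<union> M))"
    by simp
  show ?thesis
  proof (rule that[OF bij])
    show "g 0 = c"
      by (simp add: g_def)
    show "if odd i then g i \<in> M else g i \<in> P" if "i < 2 * k + 1" "i \<noteq> 0" for i
      using that bij_betwE[OF gO] bij_betwE[OF gE] by auto
  qed
qed

theorem theorem2p8:
  fixes G :: "nat pair_pre_digraph" and n :: nat and v :: "real vec" and lam :: real
  assumes "pair_graph G" and "pverts G = {0..<n}"
    and "Digraph_Component.connected (with_proj G)"
    and "eigenvector (laplacian n G) v lam"
    and "bivalent v \<or> trivalent v"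
    and "\<not> (\<exists>i j. equal_link G v i j)"
    and "\<exists>j. leaf G j"
  shows "((\<exists>f. relabeling f (path_graph 2) (vec_of_list [1, -1]) G v) \<and> lam = 2) \<or>
    (\<exists>k\<ge>1. (\<exists>f. relabeling f (star_graph (2 * k + 1)) (star_vec k) G v \<and>
                 soft_node G v (iso_verts f 0)) \<and> lam = 1)"
proof -
  interpret pair_graph G by fact
  have symG: "pair_sym_digraph G" and wfG: "pair_wf_digraph G"
    by unfold_locales
  define N where "N i = parcs G `` {i}" for i
  have arc: "(i, j) \<in> parcs G \<longleftrightarrow> j \<in> N i" for i j
    by (simp add: N_def)
  have N_sym: "j \<in> N i \<Longrightarrow> i \<in> N j" for i j
    using pair_sym_arcs by (auto simp: N_def symmetric_def elim: symE)
  have N_less: "i < n \<and> j < n" if "j \<in> N i" for i j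
    using that wellformed' assms(2) by (auto simp: N_def)
  have finN: "finite (N i)" for i
    using N_less by (intro finite_subset[of "N i" "{..<n}"]) auto
  have neq: "v $ i \<noteq> v $ j" if "j \<in> N i" for i j
    using that assms(6) by (auto simp: equal_link_def N_def)
  have "v \<in> carrier_vec n"
    using assms(4) by (simp add: eigenvector_def laplacian_def adjacency_matrix_def)
  then have val: "v $ i \<in> {-1, 0, 1}" if "i < n" for i
    using that assms(5) vec_setI[of v i "v $ i"] by (auto simp: bivalent_def trivalent_def)
  have eig: "(\<Sum>j \<in> N i. v $ i - v $ j) = lam * v $ i" if "i < n" for i
    using laplacian_eigenvector_sum[OF wfG assms(2,4) that] by (simp add: N_def)
  have lam_sum: "(\<Sum>j \<in> N i. if v $ j = 0 then 1 else 2) = lam" if "i < n" "v $ i \<noteq> 0" for i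
  proof -
    have "v $ i * v $ i = 1"
      using val[OF that(1)] that(2) by auto
    then have "lam = (\<Sum>j \<in> N i. v $ i * (v $ i - v $ j))"
      using eig[OF that(1)] by (simp flip: sum_distrib_left)
    also have "\<dots> = (\<Sum>j \<in> N i. if v $ j = 0 then 1 else 2)"
    \<comment> \<open>Without equal links, a non-soft neighbour of the non-soft \<open>i\<close> has
      the value \<open>- v $ i\<close>, which gives 2; a soft one gives the square of
      \<open>v $ i\<close>, which is 1.\<close>
    proof (rule sum.cong)
      fix j assume "j \<in> N i"
      then show "v $ i * (v $ i - v $ j) = (if v $ j = 0 then 1 else 2)"
        using val[of i] val[of j] neq[of j i] N_less[of j i] that(2) by auto
    qed simp
    finally show ?thesis ..
  qed
  obtain l u where l: "l < n" and Nl: "N l = {u}"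
    using assms(2,7) by (auto simp: leaf_def out_degree_eq_card_Image N_def card_1_singleton_iff)
  have u: "u < n" and lu: "l \<in> N u"
    using N_less[of u l] N_sym[of u l] Nl by auto
  \<comment> \<open>Were \<open>l\<close> soft, its equation would reduce to
    \<open>- v $ u = 0\<close>, making the edge between \<open>l\<close> and \<open>u\<close> an
    equal link.\<close>
  have vl: "v $ l \<noteq> 0"
    using eig[OF l] neq[of u l] Nl by auto
  show ?thesis
  proof (cases "v $ u = 0")
    case False
    have lam: "lam = 2"
      using lam_sum[OF l vl] Nl False by simp
    \<comment> \<open>The neighbour \<open>l\<close> alone contributes 2, all of \<open>lam\<close>;
      every further neighbour would add at least 1.\<close>
    have "(\<Sum>j \<in> N u - {l}. if v $ j = 0 then 1 else 2 :: real) = 0"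
      using lam_sum[OF u False] vl by (simp add: sum.remove[OF finN lu] lam)
    then have "N u - {l} = {}"
      using finN by (subst (asm) sum_nonneg_eq_0_iff) (auto split: if_splits)
    then have Nu: "N u = {l}"
      using lu by auto
    have V: "pverts G = {l, u}"
    proof
      show "pverts G \<subseteq> {l, u}"
        using assms(2) u Nl Nu
        by (intro connected_arc_closed[OF symG assms(3), of u]) (auto simp: arc)
    qed (use assms(2) l u in auto)
    have "(i, j) \<in> parcs G \<longleftrightarrow> (i, j) \<in> {(l, u), (u, l)}" for i j
      using in_arcsD1[of i j] V Nl Nu by (auto simp: arc)
    then have E: "parcs G = {(l, u), (u, l)}"
      by auto
    have lune: "l \<noteq> u"
      using neq lu by auto
    have vals: "(v $ l = 1 \<and> v $ u = -1) \<or> (v $ l = -1 \<and> v $ u = 1)"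
      using val[OF l] val[OF u] vl False neq[OF lu] by auto
    \<comment> \<open>Index 0 must go to the end of value 1, which may be \<open>l\<close> or
      \<open>u\<close>.\<close>
    define g where "g i = (if (i = (0::nat)) = (v $ l = 1) then l else u)" for i
    have path: "pverts (path_graph 2) = {0, 1}" "parcs (path_graph 2) = {(0, 1), (1, 0)}"
      by (auto simp: path_graph_def)
    have "relabeling \<lparr>iso_verts = g, iso_arcs = map_prod g g, iso_head = snd, iso_tail = fst\<rparr>
        (path_graph 2) (vec_of_list [1, -1]) G v"
      using vals lune by (intro relabelingI pair_wf_path_graph) (auto simp: path V E g_def)
    then show ?thesis
      using lam by blast
  next
    case True
    have lam: "lam = 1"
      using lam_sum[OF l vl] Nl True by simp
    \<comment> \<open>A neighbour \<open>w\<close> of the soft \<open>u\<close> is not soft, so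
      \<open>lam_sum\<close> applies to it, and the contribution 1 of \<open>u\<close> already
      exhausts \<open>lam\<close>.\<close>
    have Nw: "N w = {u}" if "w \<in> N u" for w
    proof -
      have w: "w < n" "v $ w \<noteq> 0" "u \<in> N w"
        using N_less[OF that] neq[OF that] N_sym[OF that] True by auto
      have "(\<Sum>j \<in> N w - {u}. if v $ j = 0 then 1 else 2 :: real) = 0"
        using lam_sum[OF w(1,2)] True by (simp add: sum.remove[OF finN w(3)] lam)
      then have "N w - {u} = {}"
        using finN by (subst (asm) sum_nonneg_eq_0_iff) (auto split: if_splits)
      then show ?thesis
        using w(3) by auto
    qed
    have V: "pverts G = insert u (N u)"
    proof
      show "pverts G \<subseteq> insert u (N u)"
        using assms(2) u Nw
        by (intro connected_arc_closed[OF symG assms(3), of u]) (auto simp: arc)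
    qed (use assms(2) u N_less in auto)
    have E: "(i, j) \<in> parcs G \<longleftrightarrow> i = u \<and> j \<in> N u \<or> i \<in> N u \<and> j = u" for i j
      using in_arcsD1[of i j] V Nw[of i] by (auto simp: arc)
    define P where "P = {w \<in> N u. v $ w = 1}"
    define M where "M = {w \<in> N u. v $ w = -1}"
    have "v $ w = 1 \<or> v $ w = -1" if "w \<in> N u" for w
      using val[of w] N_less[OF that] neq[OF that] True by auto
    then have PM: "N u = P \<union> M" "P \<inter> M = {}" "u \<notin> P \<union> M" "finite P" "finite M"
      using finN[of u] True by (auto simp: P_def M_def)
    have "(\<Sum>w \<in> N u. v $ w) = 0"
      using eig[OF u] True by (simp add: sum_negf)
    moreover have "(\<Sum>w \<in> N u. v $ w) = real (card P) - real (card M)"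
      unfolding PM(1) using PM by (subst sum.union_disjoint) (auto simp: P_def M_def)
    ultimately have card: "card M = card P"
      by simp
    \<comment> \<open>If \<open>P\<close> were empty, so would be \<open>M\<close>, yet
      \<open>l\<close> lies in their union \<open>N u\<close>.\<close>
    have "card P \<ge> 1"
      using PM lu card by (cases "card P") auto
    obtain g where g: "bij_betw g {0..<2 * card P + 1} (insert u (P \<union> M))" "g 0 = u"
      "\<And>i. i < 2 * card P + 1 \<Longrightarrow> i \<noteq> 0 \<Longrightarrow> if odd i then g i \<in> M else g i \<in> P"
      using bij_betw_even_odd_labels[OF PM(4,5) refl card PM(2,3)] by metis
    let ?H = "star_graph (2 * card P + 1)"
    let ?f = "\<lparr>iso_verts = g, iso_arcs = map_prod g g, iso_head = snd, iso_tail = fst\<rparr>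
      :: (nat, nat \<times> nat, nat, nat \<times> nat) digraph_isomorphism"
    have pvH: "pverts ?H = {0..<2 * card P + 1}"
      by (simp add: star_graph_def)
    have leaves: "g ` {0<..<2 * card P + 1} = N u"
    proof -
      have "{0<..<2 * card P + 1} = {0..<2 * card P + 1} - {0}"
        by auto
      then have "g ` {0<..<2 * card P + 1} = g ` {0..<2 * card P + 1} - g ` {0}"
        using g(1) by (simp add: bij_betw_def inj_on_image_set_diff[of g "{0..<2 * card P + 1}"])
      then show ?thesis
        using g(1,2) PM by (auto simp: bij_betw_def)
    qed
    \<comment> \<open>As a union of two rectangles, the arc set has an image under
      \<open>map_prod g g\<close> that is computed factor by factor.\<close>
    have paH: "parcs ?H = {0} \<times> {0<..<2 * card P + 1} \<union> {0<..<2 * card P + 1} \<times> {0}"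
      by (auto simp: star_graph_def)
    have "parcs G = {u} \<times> N u \<union> N u \<times> {u}"
      using E by auto
    then have "parcs G = map_prod g g ` parcs ?H"
      unfolding paH image_Un map_prod_surj_on[OF refl refl] leaves by (simp add: g(2))
    moreover have "v $ g i = star_vec (card P) $ i" if "i \<in> pverts ?H" for i
    proof -
      have "i < 2 * card P + 1"
        using that unfolding pvH by simp
      moreover have "x \<in> P \<Longrightarrow> v $ x = 1" "x \<in> M \<Longrightarrow> v $ x = -1" for x
        by (simp_all add: P_def M_def)
      ultimately show ?thesis
        using g(2) g(3)[of i] True by (simp add: star_vec_def split: if_splits)
    qed
    ultimately have "relabeling ?f ?H (star_vec (card P)) G v"
      using g(1) V PM(1)
      by (intro relabelingI pair_wf_star_graph) (simp_all only: pvH bij_betw_def)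
    moreover have "soft_node G v (iso_verts ?f 0)"
      using g(2) V True by (simp add: soft_node_def)
    ultimately show ?thesis
      using lam \<open>card P \<ge> 1\<close> by blast
  qed
qed

end
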